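(* Let $\mathcal H_i,\mathcal H_o$ be finite-dimensional complex Hilbert spaces with fixed computational (orthonormal) bases, $d_i=\dim\mathcal H_i$. Let $\widetilde P_i:\mathcal L(\mathcal H_i)\to\mathcal L(\mathcal H_i)$ and $\widetilde P_o:\mathcal L(\mathcal H_o)\to\mathcal L(\mathcal H_o)$ be linear projective maps ($\widetilde P_i^2=\widetilde P_i$, $\widetilde P_o^2=\widetilde P_o$), and let $\mathcal S_i$, $\mathcal S_o$ be the affine sets $$\mathcal S_i=\{W\in\mathcal L(\mathcal H_i):\widetilde P_i[W]=W,\ \operatorname{tr}[W]=\gamma_i\},\qquad \mathcal S_o=\{W'\in\mathcal L(\mathcal H_o):\widetilde P_o[W']=W',\ \operatorname{tr}[W']=\gamma_o\}.$$ Assume additionally that $\widetilde P_i$ and $\widetilde P_o$ are self-adjoint ($\widetilde P_i=\widetilde P_i^\dagger$, $\widetilde P_o=\widetilde P_o^\dagger$) and unital ($\widetilde P_i[\mathbb 1]=\mathbb 1$, $\widetilde P_o[\mathbb 1]=\mathbb 1$), and that $\widetilde P_i$ commutes with transposition ($\widetilde P_i[W^\tau]=\widetilde P_i[W]^\tau$ for all $W\in\mathcal L(\mathcal H_i)$). Then, for $\gamma_i\neq0$, a linear map $\widetilde T_{io}:\mathcal L(\mathcal H_i)\to\mathcal L(\mathcal H_o)$ satisfies $\widetilde T_{io}[W]\in\mathcal S_o$ for all $W\in\mathcal S_i$ if and only if its Choi matrix $T_{io}$ satisfies $$\widetilde P_{io}[T_{io}]:=T_{io}-(\widetilde P_i\otimes\widetilde{\mathbb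 1}_o)[T_{io}]+(\widetilde P_i\otimes\widetilde P_o)[T_{io}]-(\widetilde P_i\otimes\widetilde{\mathbb 1}_o)[{}_oT_{io}]+{}_{io}T_{io}=T_{io}$$ and $$\operatorname{tr}[T_{io}]=\frac{\gamma_o}{\gamma_i}\,d_i .$$ Here $\widetilde P_{io}:\mathcal L(\mathcal H_i\otimes\mathcal H_o)\to\mathcal L(\mathcal H_i\otimes\mathcal H_o)$ is a self-adjoint, unital projector that commutes with transposition.
   Context: $\mathcal L(\mathcal H)$ is the space of linear operators on $\mathcal H$. The Choi matrix of $\widetilde T:\mathcal L(\mathcal H_i)\to\mathcal L(\mathcal H_o)$ is $T=\sum_{jk}|j\rangle\langle k|\otimes\widetilde T[|j\rangle\langle k|]\in\mathcal L(\mathcal H_i\otimes\mathcal H_o)$, with $\{|j\rangle\}$ the computational basis of $\mathcal H_i$. $\tau$ denotes transposition in the (product) computational basis. The adjoint $\widetilde P^\dagger$ is defined by $\operatorname{tr}[B^\dagger\widetilde P[A]]=\operatorname{tr}[\widetilde P^\dagger[B]^\dagger A]$ for all $A,B$. $\widetilde{\mathbb 1}_o$ is the identity map on $\mathcal L(\mathcal H_o)$. For a tensor factor $x$ (or product of factors) of dimension $d_x$, ${}_xX:=\operatorname{tr}_x[X]\otimes\mathbb 1_x/d_x$ (with tensor factors in their original order), so ${}_oX=\operatorname{tr}_o[X]\otimes\mathbb 1_o/d_o$ and ${}_{io}X=\operatorname{tr}[X]\,\mathbb 1_{io}/(d_id_o)$. A projector is an idempotent linear map.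
   Formalization: The equivalence is stated only when P_i also preserves Hermiticity, and commutation of P_io with transposition only when P_o also commutes with transposition; both claims fail without these added assumptions. *)

theory Defs
  imports "HOL-Analysis.Analysis"
begin

text \<open>
  A finite-dimensional Hilbert space with a fixed computational basis is given by a finite index
  type; operators on it are complex square matrices in that basis, and the tensor product of two
  spaces is indexed by the product type.
\<close>

type_synonym 'n op = "complex ^ 'n ^ 'n"

text \<open>
  On nested vectors the library operation \<^term>\<open>(*s)\<close> scales by row vectors, not by complex
  numbers, so complex multiples of matrices are introduced here.
\<close>

definition smat :: "complex \<Rightarrow> 'n::finite op \<Rightarrow> 'n op" where
  "smat c A = (\<chi> i j. c * A $ i $ j)"

interpretation smat: vector_space smat
  by unfold_locales (simp_all add: smat_def vec_eq_iff algebra_simps)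

abbreviation clinear_map :: "('m::finite op \<Rightarrow> 'n::finite op) \<Rightarrow> bool" where
  "clinear_map F \<equiv> Vector_Spaces.linear smat smat F"

definition dagger :: "'n::finite op \<Rightarrow> 'n op" where
  "dagger A = (\<chi> i j. cnj (A $ j $ i))"

definition ketbra :: "'n::finite \<Rightarrow> 'n \<Rightarrow> 'n op" where
  "ketbra j k = (\<chi> a b. if a = j \<and> b = k then 1 else 0)"

definition kron :: "'m::finite op \<Rightarrow> 'n::finite op \<Rightarrow> ('m \<times> 'n) op" where
  "kron A B = (\<chi> x y. A $ fst x $ fst y * B $ snd x $ snd y)"

text \<open>
  Tensor product of linear maps, expanded in the product basis; for linear maps it is the unique
  linear map taking \<^term>\<open>kron A B\<close> to \<^term>\<open>kron (F A) (G B)\<close>, see below.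
\<close>

definition tensor_map ::
  "('a::finite op \<Rightarrow> 'c::finite op) \<Rightarrow> ('b::finite op \<Rightarrow> 'd::finite op)
    \<Rightarrow> ('a \<times> 'b) op \<Rightarrow> ('c \<times> 'd) op" where
  "tensor_map F G X = (\<Sum>j\<in>UNIV. \<Sum>k\<in>UNIV. \<Sum>l\<in>UNIV. \<Sum>m\<in>UNIV.
     smat (X $ (j, l) $ (k, m)) (kron (F (ketbra j k)) (G (ketbra l m))))"

definition choi :: "('i::finite op \<Rightarrow> 'o::finite op) \<Rightarrow> ('i \<times> 'o) op" where
  "choi T = (\<Sum>j\<in>UNIV. \<Sum>k\<in>UNIV. kron (ketbra j k) (T (ketbra j k)))"

text \<open>
  The adjoint with respect to the Hilbert-Schmidt inner product; for linear \<^term>\<open>F\<close> it exists and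
  is unique, see below.
\<close>

definition adjoint_map :: "('m::finite op \<Rightarrow> 'n::finite op) \<Rightarrow> 'n op \<Rightarrow> 'm op" where
  "adjoint_map F = (THE G. \<forall>A B. trace (dagger B ** F A) = trace (dagger (G B) ** A))"

definition projector :: "('n::finite op \<Rightarrow> 'n op) \<Rightarrow> bool" where
  "projector P \<longleftrightarrow> clinear_map P \<and> P \<circ> P = P"

definition self_adjoint :: "('n::finite op \<Rightarrow> 'n op) \<Rightarrow> bool" where
  "self_adjoint P \<longleftrightarrow> P = adjoint_map P"

definition unital :: "('n::finite op \<Rightarrow> 'n op) \<Rightarrow> bool" where
  "unital P \<longleftrightarrow> P (mat 1) = mat 1"

definition commutes_with_transpose :: "('n::finite op \<Rightarrow> 'n op) \<Rightarrow> bool" where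
  "commutes_with_transpose P \<longleftrightarrow> (\<forall>W. P (transpose W) = transpose (P W))"

text \<open>
  Self-adjointness and commutation with the transpose do not imply that a projector preserves
  Hermiticity: the orthogonal projector onto the span of the identity and the complex symmetric
  matrix with rows (1, i) and (i, -1) is a counterexample. Preservation of Hermiticity is what makes
  such a projector its own transpose for the bilinear pairing of \<^term>\<open>A\<close> and \<^term>\<open>B\<close> given by
  \<^term>\<open>trace (A ** B)\<close>.
\<close>

definition hermiticity_preserving :: "('n::finite op \<Rightarrow> 'n op) \<Rightarrow> bool" where
  "hermiticity_preserving P \<longleftrightarrow> (\<forall>W. dagger W = W \<longrightarrow> dagger (P W) = P W)"

definition affine_class :: "('n::finite op \<Rightarrow> 'n op) \<Rightarrow> complex \<Rightarrow> 'n op set" where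
  "affine_class P \<gamma> = {W. P W = W \<and> trace W = \<gamma>}"

definition partial_trace_out :: "('i::finite \<times> 'o::finite) op \<Rightarrow> 'i op" where
  "partial_trace_out X = (\<chi> j k. \<Sum>l\<in>UNIV. X $ (j, l) $ (k, l))"

text \<open>\<^term>\<open>depol_out X\<close> and \<^term>\<open>depol_all X\<close> are the operators often written
  \<open>\<^sub>oX\<close> and \<open>\<^sub>i\<^sub>oX\<close>, with prefixed subscripts.\<close>

definition depol_out :: "('i::finite \<times> 'o::finite) op \<Rightarrow> ('i \<times> 'o) op" where
  "depol_out X = kron (partial_trace_out X) (smat (1 / of_nat CARD('o)) (mat 1))"

definition depol_all :: "('i::finite \<times> 'o::finite) op \<Rightarrow> ('i \<times> 'o) op" where
  "depol_all X = smat (trace X / (of_nat CARD('i) * of_nat CARD('o))) (mat 1)"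

definition P_io ::
  "('i::finite op \<Rightarrow> 'i op) \<Rightarrow> ('o::finite op \<Rightarrow> 'o op) \<Rightarrow> ('i \<times> 'o) op \<Rightarrow> ('i \<times> 'o) op" where
  "P_io P\<^sub>i P\<^sub>o X = X - tensor_map P\<^sub>i id X + tensor_map P\<^sub>i P\<^sub>o X
     - tensor_map P\<^sub>i id (depol_out X) + depol_all X"


lemma clinear_ketbra_expansion:
  fixes F :: "'m::finite op \<Rightarrow> 'n::finite op"
  assumes "clinear_map F"
  shows "F A = (\<Sum>j\<in>UNIV. \<Sum>k\<in>UNIV. smat (A $ j $ k) (F (ketbra j k)))"
proof -
  interpret Vector_Spaces.linear smat smat F by fact
  have A: "A = (\<Sum>j\<in>UNIV. \<Sum>k\<in>UNIV. smat (A $ j $ k) (ketbra j k))"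
  proof (intro vec_eq_iff[THEN iffD2] allI)
    fix a b
    have "(\<Sum>j\<in>UNIV. \<Sum>k\<in>UNIV. smat (A $ j $ k) (ketbra j k)) $ a $ b
        = (\<Sum>j\<in>UNIV. \<Sum>k\<in>UNIV. smat (A $ j $ k) (ketbra j k) $ a $ b)"
      by simp
    also have "\<dots>
        = (\<Sum>j\<in>UNIV. \<Sum>k\<in>UNIV. if k = b then if j = a then A $ j $ k else 0 else 0)"
      by (intro sum.cong refl) (auto simp: smat_def ketbra_def)
    also have "\<dots> = A $ a $ b" by simp
    finally show "A $ a $ b = (\<Sum>j\<in>UNIV. \<Sum>k\<in>UNIV. smat (A $ j $ k) (ketbra j k)) $ a $ b" by simp
  qed
  have "F A = F (\<Sum>j\<in>UNIV. \<Sum>k\<in>UNIV. smat (A $ j $ k) (ketbra j k))" using A by simp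
  also have "\<dots> = (\<Sum>j\<in>UNIV. \<Sum>k\<in>UNIV. smat (A $ j $ k) (F (ketbra j k)))"
    by (simp add: sum scale)
  finally show ?thesis .
qed

lemma tensor_map_kron:
  fixes F :: "'a::finite op \<Rightarrow> 'c::finite op" and G :: "'b::finite op \<Rightarrow> 'd::finite op"
  assumes F: "clinear_map F" and G: "clinear_map G"
  shows "tensor_map F G (kron A B) = kron (F A) (G B)"
  unfolding clinear_ketbra_expansion[OF F, of A] clinear_ketbra_expansion[OF G, of B]
proof (intro vec_eq_iff[THEN iffD2] allI, goal_cases)
  case (1 p q)
  define f where "f j k l m =
    A $ j $ k * B $ l $ m * (F (ketbra j k) $ fst p $ fst q * G (ketbra l m) $ snd p $ snd q)"
    for j k l m
  have "tensor_map F G (kron A B) $ p $ q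
      = (\<Sum>j\<in>UNIV. \<Sum>k\<in>UNIV. \<Sum>l\<in>UNIV. \<Sum>m\<in>UNIV. f j k l m)"
    by (simp add: tensor_map_def kron_def smat_def f_def)
  also have "\<dots> = (\<Sum>j\<in>UNIV. \<Sum>k\<in>UNIV. A $ j $ k * F (ketbra j k) $ fst p $ fst q)
      * (\<Sum>l\<in>UNIV. \<Sum>m\<in>UNIV. B $ l $ m * G (ketbra l m) $ snd p $ snd q)"
    by (simp only: sum_distrib_right, simp only: sum_distrib_left f_def ac_simps)
  finally show ?case by (simp add: kron_def smat_def)
qed

lemma linear_tensor_map: "clinear_map (tensor_map F G)"
  unfolding Vector_Spaces.linear_iff
  by (simp add: smat.vector_space_axioms)
    (simp add: tensor_map_def vec_eq_iff smat_def algebra_simps sum.distrib sum_distrib_left)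

lemma trace_dagger_mult:
  "trace (dagger B ** A) = (\<Sum>j\<in>UNIV. \<Sum>k\<in>UNIV. cnj (B $ j $ k) * A $ j $ k)"
  unfolding trace_def matrix_matrix_mult_def dagger_def by (simp, rule sum.swap)

lemma trace_dagger_ketbra: "trace (dagger B ** ketbra j k) = cnj (B $ j $ k)"
proof -
  have "trace (dagger B ** ketbra j k)
      = (\<Sum>a\<in>UNIV. \<Sum>b\<in>UNIV. if b = k then if a = j then cnj (B $ a $ b) else 0 else 0)"
    unfolding trace_dagger_mult by (intro sum.cong) (auto simp: ketbra_def)
  then show ?thesis by simp
qed

lemma adjoint_map_eq_iff:
  fixes F :: "'m::finite op \<Rightarrow> 'n::finite op"
  assumes F: "clinear_map F"
  shows "G = adjoint_map F \<longleftrightarrow> (\<forall>A B. trace (dagger B ** F A) = trace (dagger (G B) ** A))"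
proof -
  let ?Q = "\<lambda>G. \<forall>A B. trace (dagger B ** F A) = trace (dagger (G B) ** A)"
  define G0 :: "'n op \<Rightarrow> 'm op"
    where "G0 = (\<lambda>B. \<chi> j k. cnj (trace (dagger B ** F (ketbra j k))))"
  have ex: "?Q G0"
  proof (intro allI)
    fix A B
    have "trace (dagger B ** F A)
        = (\<Sum>j\<in>UNIV. \<Sum>k\<in>UNIV. A $ j $ k * trace (dagger B ** F (ketbra j k)))"
      unfolding clinear_ketbra_expansion[OF F, of A] trace_dagger_mult
      apply (simp add: smat_def sum_distrib_left mult_ac)
      apply (subst (2) sum.swap)
      apply (subst sum.swap)
      apply (subst (3) sum.swap)
      apply (subst (2) sum.swap)
      apply (rule refl)
      done
    then show "trace (dagger B ** F A) = trace (dagger (G0 B) ** A)"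
      unfolding trace_dagger_mult[of "G0 B"] by (simp add: G0_def mult_ac)
  qed
  have uniq: "H = G0" if "?Q H" for H
  proof (intro ext vec_eq_iff[THEN iffD2] allI)
    fix B j k
    have "cnj (H B $ j $ k) = cnj (G0 B $ j $ k)"
      using that ex by (metis trace_dagger_ketbra)
    then show "H B $ j $ k = G0 B $ j $ k" by simp
  qed
  have "adjoint_map F = G0"
    unfolding adjoint_map_def by (rule the_equality) (use ex uniq in auto)
  then show ?thesis using ex uniq by auto
qed

lemma self_adjoint_iff:
  assumes "clinear_map P"
  shows "self_adjoint P \<longleftrightarrow> (\<forall>A B. trace (dagger B ** P A) = trace (dagger (P B) ** A))"
  unfolding self_adjoint_def by (rule adjoint_map_eq_iff[OF assms])

end

theory Submission
  imports Defs
begin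

text \<open>
  Let \<open>D A = tr A / d \<cdot> 1\<close> be the depolarizing map. Then \<open>P_io\<close> is
  \<open>1 \<otimes> 1 - P\<^sub>i \<otimes> 1 + P\<^sub>i \<otimes> P\<^sub>o - P\<^sub>i \<otimes> D + D \<otimes> D\<close>, the alternating sum of a decreasing chain of
  commuting orthogonal projectors, because a self-adjoint unital projector absorbs \<open>D\<close> on both
  sides. On Choi matrices, \<open>F \<otimes> G\<close> acts as \<open>T \<mapsto> G \<circ> T \<circ> F\<close> as soon as \<open>F\<close> is its own transpose for the
  bilinear trace pairing. The fixed-point equation therefore reads
  \<open>T P\<^sub>i + D T P\<^sub>i = P\<^sub>o T P\<^sub>i + D T D\<close>; composing with \<open>D\<close> splits it into \<open>D T P\<^sub>i = D T D\<close> and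
  \<open>T P\<^sub>i = P\<^sub>o T P\<^sub>i\<close>, which say that \<open>T\<close> rescales the trace by a constant on the range of \<open>P\<^sub>i\<close> and
  maps this range into that of \<open>P\<^sub>o\<close>.
\<close>

section \<open>Linear maps on operators and matrix units\<close>

lemma clinear_iff:
  "clinear_map F \<longleftrightarrow> (\<forall>A B. F (A + B) = F A + F B) \<and> (\<forall>c A. F (smat c A) = smat c (F A))"
  unfolding Vector_Spaces.linear_iff by (simp add: smat.vector_space_axioms)

lemma clinear_add: "clinear_map F \<Longrightarrow> F (A + B) = F A + F B"
  and clinear_smat: "clinear_map F \<Longrightarrow> F (smat c A) = smat c (F A)"
  by (simp_all add: clinear_iff)

lemma clinear_diff: "clinear_map F \<Longrightarrow> F (A - B) = F A - F B"
  by (metis clinear_add add_diff_cancel_right' diff_add_cancel)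

lemma clinear_sum:
  assumes "clinear_map F"
  shows "F (\<Sum>x\<in>S. f x) = (\<Sum>x\<in>S. F (f x))"
proof -
  interpret Vector_Spaces.linear smat smat F by fact
  show ?thesis by (rule sum)
qed

lemma clinear_id: "clinear_map id"
  by (simp add: clinear_iff)

lemma clinear_comp: "clinear_map F \<Longrightarrow> clinear_map G \<Longrightarrow> clinear_map (F \<circ> G)"
  by (simp add: clinear_iff)

lemma clinear_plus: "clinear_map F \<Longrightarrow> clinear_map G \<Longrightarrow> clinear_map (\<lambda>A. F A + G A)"
  by (simp add: clinear_iff smat.scale_right_distrib add_ac)

lemma clinear_minus: "clinear_map F \<Longrightarrow> clinear_map G \<Longrightarrow> clinear_map (\<lambda>A. F A - G A)"
  by (simp add: clinear_iff smat.scale_right_diff_distrib)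

lemma clinear_transpose: "clinear_map transpose"
  by (simp add: clinear_iff transpose_def smat_def vec_eq_iff)

lemma clinear_eqI:
  assumes "clinear_map F" "clinear_map G" "\<And>j k. F (ketbra j k) = G (ketbra j k)"
  shows "F = G"
proof
  show "F A = G A" for A
    using clinear_ketbra_expansion[OF assms(1), of A] clinear_ketbra_expansion[OF assms(2), of A]
      assms(3) by simp
qed

lemma transpose_ketbra: "transpose (ketbra j k) = ketbra k j"
  by (auto simp: transpose_def ketbra_def vec_eq_iff)

lemma dagger_ketbra: "dagger (ketbra j k) = ketbra k j"
  by (auto simp: dagger_def ketbra_def vec_eq_iff)

text \<open>With \<open>clinear_eqI\<close> this reduces an identity between linear maps on a tensor
  product to product operators, where \<open>tensor_map_kron\<close> evaluates both sides.\<close>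

lemma ketbra_prod: "ketbra p q = kron (ketbra (fst p) (fst q)) (ketbra (snd p) (snd q))"
  by (auto simp: kron_def ketbra_def vec_eq_iff prod_eq_iff)

lemma kron_mat_1: "kron (mat 1) (mat 1) = mat 1"
  by (auto simp: kron_def mat_def vec_eq_iff prod_eq_iff)

lemma transpose_kron: "transpose (kron A B) = kron (transpose A) (transpose B)"
  by (simp add: transpose_def kron_def vec_eq_iff)

lemma trace_smat: "trace (smat c A) = c * trace A"
  by (simp add: trace_def smat_def sum_distrib_left)

lemma trace_mat_1: "trace (mat 1 :: 'n::finite op) = of_nat CARD('n)"
  by (simp add: trace_def mat_def)

lemma trace_ketbra: "trace (ketbra j k) = (if j = k then 1 else 0)"
proof -
  have "trace (ketbra j k) = (\<Sum>a\<in>UNIV. if a = j then (if j = k then 1 else 0) else 0)"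
    unfolding trace_def by (intro sum.cong) (auto simp: ketbra_def)
  then show ?thesis by simp
qed

section \<open>Self-adjoint maps\<close>

lemma trace_dagger_cnj: "trace (dagger B ** A) = cnj (trace (dagger A ** B))"
  by (simp add: trace_dagger_mult mult.commute)

text \<open>The matrix units are orthonormal for the Hilbert-Schmidt product, so self-adjointness
  means that the coefficient matrix of \<open>P\<close> in them is Hermitian. In this form it
  visibly passes to sums, differences and tensor products.\<close>

lemma self_adjoint_iff_entries:
  assumes P: "clinear_map P"
  shows "self_adjoint P \<longleftrightarrow>
    (\<forall>a b j k. cnj (P (ketbra a b) $ j $ k) = P (ketbra j k) $ a $ b)"
proof
  assume "self_adjoint P"
  then have sa: "trace (dagger B ** P A) = trace (dagger (P B) ** A)" for A B
    using self_adjoint_iff[OF P] by blast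
  show "\<forall>a b j k. cnj (P (ketbra a b) $ j $ k) = P (ketbra j k) $ a $ b"
  proof (intro allI)
    fix a b j k
    have "cnj (P (ketbra a b) $ j $ k) = trace (dagger (ketbra a b) ** P (ketbra j k))"
      by (simp add: sa trace_dagger_ketbra)
    also have "\<dots> = P (ketbra j k) $ a $ b"
      by (subst trace_dagger_cnj) (simp add: trace_dagger_ketbra)
    finally show "cnj (P (ketbra a b) $ j $ k) = P (ketbra j k) $ a $ b" .
  qed
next
  assume entry: "\<forall>a b j k. cnj (P (ketbra a b) $ j $ k) = P (ketbra j k) $ a $ b"
  have "trace (dagger B ** P A) = trace (dagger (P B) ** A)" for A B
  proof -
    have "trace (dagger B ** P A) = (\<Sum>a\<in>UNIV. \<Sum>b\<in>UNIV. \<Sum>j\<in>UNIV. \<Sum>k\<in>UNIV.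
        cnj (B $ a $ b) * (A $ j $ k * P (ketbra j k) $ a $ b))"
      unfolding clinear_ketbra_expansion[OF P, of A] trace_dagger_mult
      by (simp add: smat_def sum_distrib_left)
    also have "\<dots> = (\<Sum>j\<in>UNIV. \<Sum>k\<in>UNIV. \<Sum>a\<in>UNIV. \<Sum>b\<in>UNIV.
        cnj (B $ a $ b) * (A $ j $ k * P (ketbra j k) $ a $ b))"
      \<comment> \<open>Four swaps of adjacent sums carry the indices \<open>j\<close>,
        \<open>k\<close> past \<open>a\<close>, \<open>b\<close>.\<close>
      apply (subst (2) sum.swap)
      apply (subst sum.swap)
      apply (subst (3) sum.swap)
      apply (subst (2) sum.swap)
      apply (rule refl)
      done
    also have "\<dots> = trace (dagger (P B) ** A)"
      unfolding clinear_ketbra_expansion[OF P, of B] trace_dagger_mult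
      by (simp add: smat_def sum_distrib_right mult_ac entry) (simp add: sum_distrib_left)
    finally show ?thesis .
  qed
  then show "self_adjoint P" using self_adjoint_iff[OF P] by blast
qed

lemma self_adjoint_id: "self_adjoint id"
  using self_adjoint_iff[OF clinear_id] by auto

lemma self_adjoint_plus:
  assumes "clinear_map F" "clinear_map G" "self_adjoint F" "self_adjoint G"
  shows "self_adjoint (\<lambda>A. F A + G A)"
  using assms(3,4)
  unfolding self_adjoint_iff_entries[OF assms(1)] self_adjoint_iff_entries[OF assms(2)]
    self_adjoint_iff_entries[OF clinear_plus[OF assms(1,2)]]
  by simp

lemma self_adjoint_minus:
  assumes "clinear_map F" "clinear_map G" "self_adjoint F" "self_adjoint G"
  shows "self_adjoint (\<lambda>A. F A - G A)"
  using assms(3,4)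
  unfolding self_adjoint_iff_entries[OF assms(1)] self_adjoint_iff_entries[OF assms(2)]
    self_adjoint_iff_entries[OF clinear_minus[OF assms(1,2)]]
  by simp

lemma self_adjoint_tensor_map:
  assumes "clinear_map F" "clinear_map G" "self_adjoint F" "self_adjoint G"
  shows "self_adjoint (tensor_map F G)"
proof -
  have "cnj (F (ketbra a b) $ j $ k) = F (ketbra j k) $ a $ b"
    and "cnj (G (ketbra c d) $ l $ m) = G (ketbra l m) $ c $ d" for a b j k c d l m
    using assms by (simp_all add: self_adjoint_iff_entries)
  then have "cnj (kron (F (ketbra a b)) (G (ketbra c d)) $ p $ q)
      = kron (F (ketbra (fst p) (fst q))) (G (ketbra (snd p) (snd q))) $ (a, c) $ (b, d)"
    for a b c d p q
    by (simp add: kron_def)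
  then show ?thesis
    unfolding self_adjoint_iff_entries[OF linear_tensor_map]
    by (simp add: ketbra_prod tensor_map_kron[OF assms(1,2)])
qed

text \<open>The trace is the pairing with the identity, and self-adjointness moves \<open>P\<close>
  onto the identity, which it fixes.\<close>

lemma trace_self_adjoint_unital:
  assumes "clinear_map P" "self_adjoint P" "unital P"
  shows "trace (P A) = trace A"
proof -
  have 1: "dagger (mat 1) = mat 1"
    by (auto simp: dagger_def mat_def vec_eq_iff)
  have "trace (dagger (mat 1) ** P A) = trace (dagger (P (mat 1)) ** A)"
    using assms(2) self_adjoint_iff[OF assms(1)] by blast
  then show ?thesis using assms(3) by (simp add: 1 unital_def)
qed

section \<open>The depolarizing map and tensor products\<close>

text \<open>The orthogonal projector onto the multiples of the identity. It carries exactly the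
  trace, so trace conditions can be written as equations between operators.\<close>

definition depol :: "'n::finite op \<Rightarrow> 'n op" where
  "depol A = smat (trace A / of_nat CARD('n)) (mat 1)"

lemma clinear_depol: "clinear_map depol"
  by (simp add: clinear_iff depol_def trace_smat trace_add smat.scale_left_distrib
      add_divide_distrib)

lemma trace_depol: "trace (depol A) = trace A"
  by (simp add: depol_def trace_smat trace_mat_1)

lemma depol_eq_iff: "depol A = depol B \<longleftrightarrow> trace A = trace B"
  by (metis depol_def trace_depol)

lemma depol_idem: "depol (depol A) = depol A"
  by (simp add: depol_eq_iff trace_depol)

lemma depol_mat_1: "depol (mat 1) = mat 1"
  by (simp add: depol_def trace_mat_1)

lemma transpose_depol: "depol (transpose A) = transpose (depol A)"
  by (simp add: depol_def smat_def trace_def transpose_def mat_def vec_eq_iff)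

lemma self_adjoint_depol: "self_adjoint depol"
  unfolding self_adjoint_iff_entries[OF clinear_depol]
  by (simp add: depol_def trace_ketbra smat_def mat_def)

lemma unital_depol: "clinear_map P \<Longrightarrow> unital P \<Longrightarrow> P (depol A) = depol A"
  by (simp add: depol_def clinear_smat unital_def)

lemma tensor_map_comp:
  assumes "clinear_map F" "clinear_map G" "clinear_map F'" "clinear_map G'"
  shows "tensor_map F G (tensor_map F' G' X) = tensor_map (F \<circ> F') (G \<circ> G') X"
proof -
  have "tensor_map F G \<circ> tensor_map F' G' = tensor_map (F \<circ> F') (G \<circ> G')"
    by (rule clinear_eqI)
      (simp_all add: clinear_comp linear_tensor_map ketbra_prod tensor_map_kron assms)
  then show ?thesis by (metis comp_apply)
qed

lemma transpose_tensor_map: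
  assumes F: "clinear_map F" "commutes_with_transpose F"
    and G: "clinear_map G" "commutes_with_transpose G"
  shows "tensor_map F G (transpose X) = transpose (tensor_map F G X)"
proof -
  have "tensor_map F G \<circ> transpose = transpose \<circ> tensor_map F G"
    by (rule clinear_eqI)
      (use F(2) G(2) in \<open>simp_all add: clinear_comp clinear_transpose linear_tensor_map ketbra_prod
        tensor_map_kron F(1) G(1) transpose_kron commutes_with_transpose_def\<close>)
  then show ?thesis by (metis comp_apply)
qed

lemma depol_out_eq: "depol_out = tensor_map id depol"
proof (rule clinear_eqI[OF _ linear_tensor_map])
  show "clinear_map (depol_out :: ('a \<times> 'b) op \<Rightarrow> _)"
    by (simp add: clinear_iff depol_out_def partial_trace_out_def kron_def smat_def vec_eq_iff
        sum.distrib sum_distrib_left algebra_simps)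
  show "depol_out (ketbra p q) = tensor_map id depol (ketbra p q)" for p q :: "'a \<times> 'b"
  proof -
    have "partial_trace_out (kron A B) = smat (trace B) A" for A :: "'a op" and B :: "'b op"
      by (simp add: partial_trace_out_def kron_def smat_def trace_def vec_eq_iff sum_distrib_left
          mult.commute)
    then show ?thesis
      by (simp add: depol_out_def ketbra_prod tensor_map_kron clinear_id clinear_depol)
        (simp add: depol_def kron_def smat_def vec_eq_iff)
  qed
qed

lemma trace_kron: "trace (kron A B) = trace A * trace B"
  by (simp add: trace_def kron_def sum_product sum.cartesian_product case_prod_beta)

lemma depol_all_eq:
  "depol_all = (tensor_map depol depol :: ('a::finite \<times> 'b::finite) op \<Rightarrow> ('a \<times> 'b) op)"
proof -
  have "depol_all = (depol :: ('a \<times> 'b) op \<Rightarrow> ('a \<times> 'b) op)"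
    by (simp add: fun_eq_iff depol_all_def depol_def)
  also have "\<dots> = tensor_map depol depol"
  proof (rule clinear_eqI[OF clinear_depol linear_tensor_map])
    have "depol (kron A B) = kron (depol A) (depol B)" for A :: "'a op" and B :: "'b op"
      unfolding depol_def trace_kron
      by (simp add: smat_def vec_eq_iff kron_def mat_def prod_eq_iff)
    then show "depol (ketbra p q) = tensor_map depol depol (ketbra p q)" for p q :: "'a \<times> 'b"
      by (simp add: ketbra_prod tensor_map_kron clinear_depol)
  qed
  finally show ?thesis .
qed

text \<open>All five terms become tensor products of maps, the first being the identity:
  \<open>tensor_map P id\<close> after \<open>tensor_map id depol\<close> merges into
  \<open>tensor_map P depol\<close>.\<close>

lemma P_io_eq:
  assumes "clinear_map P"
  shows "P_io P Q X = X - tensor_map P id X + tensor_map P Q X - tensor_map P depol X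
    + tensor_map depol depol X"
  by (simp add: P_io_def depol_out_eq depol_all_eq tensor_map_comp assms clinear_id clinear_depol)

section \<open>Properties of the projector\<close>

context
  fixes P :: "'i::finite op \<Rightarrow> 'i op" and Q :: "'o::finite op \<Rightarrow> 'o op"
  assumes P: "projector P" "self_adjoint P" "unital P"
    and Q: "projector Q" "self_adjoint Q" "unital Q"
begin

private lemma lin: "clinear_map P" "clinear_map Q"
  using P Q by (simp_all add: projector_def)

text \<open>The multiplication table of the chain id (x) id, P (x) id, P (x) Q, P (x) depol, depol
  (x) depol: a product of two members is the later one. Hence the alternating sum is idempotent,
  being a sum of mutually orthogonal differences and the last member.\<close>

private lemma absorb:
  "P \<circ> P = P" "Q \<circ> Q = Q" "depol \<circ> P = depol" "P \<circ> depol = depol"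
  "depol \<circ> Q = depol" "Q \<circ> depol = depol"
  "depol \<circ> depol = (depol :: 'i op \<Rightarrow> 'i op)" "depol \<circ> depol = (depol :: 'o op \<Rightarrow> 'o op)"
  using P Q
  by (auto simp: fun_eq_iff depol_eq_iff unital_depol lin trace_self_adjoint_unital depol_idem
      projector_def)

lemma projector_P_io: "projector (P_io P Q)"
proof -
  have "clinear_map (P_io P Q)"
    unfolding P_io_eq[OF lin(1), abs_def]
    by (intro clinear_plus clinear_minus linear_tensor_map) (simp add: clinear_iff)
  moreover have "P_io P Q (P_io P Q X) = P_io P Q X" for X
    by (simp add: P_io_eq[OF lin(1)] clinear_add[OF linear_tensor_map]
        clinear_diff[OF linear_tensor_map] tensor_map_comp lin clinear_id clinear_depol absorb)
  ultimately show ?thesis by (simp add: projector_def fun_eq_iff)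
qed

lemma self_adjoint_P_io: "self_adjoint (P_io P Q)"
  unfolding P_io_eq[OF lin(1), abs_def]
  \<comment> \<open>The leading term appears as the abstraction returning its argument instead of
    the constant \<open>id\<close>, hence the two facts with \<open>id_def\<close> unfolded.\<close>
  by (intro self_adjoint_plus self_adjoint_minus clinear_plus clinear_minus linear_tensor_map
      self_adjoint_tensor_map lin clinear_id clinear_depol self_adjoint_id self_adjoint_depol
      P(2) Q(2) clinear_id[unfolded id_def] self_adjoint_id[unfolded id_def])

lemma unital_P_io: "unital (P_io P Q)"
proof -
  have "tensor_map F G (mat 1) = mat 1"
    if "clinear_map F" "F (mat 1) = mat 1" "clinear_map G" "G (mat 1) = mat 1"
    for F :: "'i op \<Rightarrow> 'i op" and G :: "'o op \<Rightarrow> 'o op"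
    using tensor_map_kron[OF that(1,3), of "mat 1" "mat 1"] that by (simp add: kron_mat_1)
  then show ?thesis
    using P(3) Q(3)
    by (simp add: unital_def P_io_eq[OF lin(1)] lin clinear_id clinear_depol depol_mat_1)
qed

lemma commutes_with_transpose_P_io:
  assumes "commutes_with_transpose P" "commutes_with_transpose Q"
  shows "commutes_with_transpose (P_io P Q)"
proof -
  have id: "commutes_with_transpose id" and depol: "commutes_with_transpose depol"
    by (simp_all add: commutes_with_transpose_def transpose_depol)
  have "P_io P Q (transpose X) = transpose (P_io P Q X)" for X
    unfolding P_io_eq[OF lin(1)]
    by (simp add: transpose_tensor_map assms id depol lin clinear_id clinear_depol
        clinear_add[OF clinear_transpose] clinear_diff[OF clinear_transpose])
  then show ?thesis by (simp add: commutes_with_transpose_def)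
qed

end

section \<open>The action on Choi matrices\<close>

lemma choi_nth: "choi T $ p $ q = T (ketbra (fst p) (fst q)) $ snd p $ snd q"
proof -
  have "choi T $ p $ q = (\<Sum>j\<in>UNIV. \<Sum>k\<in>UNIV.
      if k = fst q then if j = fst p then T (ketbra j k) $ snd p $ snd q else 0 else 0)"
    unfolding choi_def sum_component by (intro sum.cong) (auto simp: kron_def ketbra_def)
  then show ?thesis by simp
qed

lemma choi_eq_iff:
  assumes "clinear_map S" "clinear_map T"
  shows "choi S = choi T \<longleftrightarrow> S = T"
proof
  assume eq: "choi S = choi T"
  have "S (ketbra j k) $ l $ m = T (ketbra j k) $ l $ m" for j k l m
    using arg_cong[OF eq, of "\<lambda>X. X $ (j, l) $ (k, m)"] by (simp add: choi_nth)
  then show "S = T"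
    by (intro clinear_eqI[OF assms]) (simp add: vec_eq_iff)
qed simp

text \<open>Only the diagonal matrix units contribute to the trace of the Choi matrix, and they sum
  to the identity.\<close>

lemma trace_choi:
  assumes "clinear_map T"
  shows "trace (choi T) = trace (T (mat 1))"
proof -
  have "T (mat 1) = (\<Sum>j\<in>UNIV. \<Sum>k\<in>UNIV. if k = j then T (ketbra j k) else 0)"
    unfolding clinear_ketbra_expansion[OF assms, of "mat 1"]
    by (intro sum.cong) (auto simp: mat_def)
  then have "trace (T (mat 1)) = (\<Sum>l\<in>UNIV. \<Sum>j\<in>UNIV. T (ketbra j j) $ l $ l)"
    by (simp add: trace_def)
  also have "\<dots> = (\<Sum>j\<in>UNIV. \<Sum>l\<in>UNIV. T (ketbra j j) $ l $ l)"
    by (rule sum.swap)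
  also have "\<dots> = trace (choi T)"
    by (simp add: trace_def choi_nth sum.cartesian_product case_prod_beta)
  finally show ?thesis by simp
qed

text \<open>The coefficient matrix in the matrix units is symmetric instead of Hermitian:
  \<open>F\<close> is its own transpose for the pairing \<open>trace (transpose A ** B)\<close>. The
  Choi matrix turns a map on the input factor into the transposed map acting before
  \<open>T\<close>.\<close>

definition bilinear_symmetric :: "('n::finite op \<Rightarrow> 'n op) \<Rightarrow> bool" where
  "bilinear_symmetric F \<longleftrightarrow> (\<forall>a b j k. F (ketbra j k) $ a $ b = F (ketbra a b) $ j $ k)"

lemma bilinear_symmetric_depol: "bilinear_symmetric depol"
  by (simp add: bilinear_symmetric_def depol_def trace_ketbra smat_def mat_def)

text \<open>Split \<open>A\<close> into Hermitian parts, A = H + i K; the adjoint of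
  \<open>A\<close> is then H - i K, and \<open>F\<close> keeps the images of \<open>H\<close> and
  \<open>K\<close> Hermitian.\<close>

lemma hermiticity_preserving_dagger:
  assumes F: "clinear_map F" and "hermiticity_preserving F"
  shows "F (dagger A) = dagger (F A)"
proof -
  have herm: "dagger (F W) = F W" if "dagger W = W" for W
    using assms(2) that by (simp add: hermiticity_preserving_def)
  have dadd: "dagger (X + Y) = dagger X + dagger Y"
    and dsmat: "dagger (smat c X) = smat (cnj c) (dagger X)"
    and dd: "dagger (dagger X) = X" for X Y :: "'a op" and c
    by (simp_all add: dagger_def smat_def vec_eq_iff)
  define H where "H = smat (1/2) (A + dagger A)"
  define K where "K = smat (- \<i>/2) (A - dagger A)"
  have H: "dagger H = H"
    by (simp add: H_def dsmat dadd dd add.commute)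
  have K: "dagger K = K"
    by (simp add: K_def dagger_def smat_def vec_eq_iff field_simps)
  have A: "A = H + smat \<i> K" and A': "dagger A = H + smat (- \<i>) K"
    by (simp_all add: H_def K_def dagger_def smat_def vec_eq_iff field_simps)
  have "F (dagger A) = F H + smat (- \<i>) (F K)"
    unfolding A' by (simp add: clinear_add[OF F] clinear_smat[OF F] del: smat.scale_minus_left)
  also have "\<dots> = dagger (F H + smat \<i> (F K))"
    by (simp add: dadd dsmat herm H K)
  also have "\<dots> = dagger (F A)"
    by (subst A) (simp add: clinear_add[OF F] clinear_smat[OF F])
  finally show ?thesis .
qed

text \<open>Self-adjointness exchanges the two index pairs at the price of a conjugation.
  Preservation of Hermiticity trades the conjugation for a swap inside each pair, and commutation
  with transposition undoes that swap.\<close>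

lemma bilinear_symmetricI:
  assumes F: "clinear_map F" and "self_adjoint F" "commutes_with_transpose F"
    and "hermiticity_preserving F"
  shows "bilinear_symmetric F"
  unfolding bilinear_symmetric_def
proof (intro allI)
  fix a b j k
  have "F (ketbra j k) $ a $ b = cnj (F (ketbra a b) $ j $ k)"
    using assms(2) by (simp add: self_adjoint_iff_entries[OF F])
  also have "\<dots> = F (ketbra b a) $ k $ j"
    using hermiticity_preserving_dagger[OF F assms(4), of "ketbra a b"]
    by (simp add: dagger_ketbra) (simp add: dagger_def)
  also have "\<dots> = F (ketbra a b) $ j $ k"
  proof -
    have "F (transpose (ketbra a b)) = transpose (F (ketbra a b))"
      using assms(3) by (simp add: commutes_with_transpose_def)
    then show ?thesis by (simp add: transpose_ketbra) (simp add: transpose_def)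
  qed
  finally show "F (ketbra j k) $ a $ b = F (ketbra a b) $ j $ k" .
qed

lemma tensor_map_choi:
  assumes F: "clinear_map F" "bilinear_symmetric F" and G: "clinear_map G" and T: "clinear_map T"
  shows "tensor_map F G (choi T) = choi (G \<circ> T \<circ> F)"
proof -
  have GT: "clinear_map (G \<circ> T)" by (intro clinear_comp G T)
  have "tensor_map F G (choi T) $ p $ q = choi (G \<circ> T \<circ> F) $ p $ q" for p q
  proof -
    have "tensor_map F G (choi T) =
        (\<Sum>j\<in>UNIV. \<Sum>k\<in>UNIV. kron (F (ketbra j k)) ((G \<circ> T) (ketbra j k)))"
      unfolding choi_def
      by (simp add: clinear_sum[OF linear_tensor_map] tensor_map_kron[OF F(1) G])
    \<comment> \<open>Symmetry of \<open>F\<close> makes the coefficients of the sum the entries of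
      one operator, the image under \<open>F\<close> of a fixed matrix unit. The sum is then the
      expansion of \<open>G \<circ> T\<close> at that operator.\<close>
    then have "tensor_map F G (choi T) $ p $ q = (\<Sum>j\<in>UNIV. \<Sum>k\<in>UNIV.
        F (ketbra (fst p) (fst q)) $ j $ k * (G \<circ> T) (ketbra j k) $ snd p $ snd q)"
      using F(2) by (simp add: kron_def bilinear_symmetric_def)
    also have "\<dots> = (G \<circ> T) (F (ketbra (fst p) (fst q))) $ snd p $ snd q"
      by (subst clinear_ketbra_expansion[OF GT, of "F _"]) (simp add: smat_def)
    finally show ?thesis by (simp add: choi_nth)
  qed
  then show ?thesis by (simp add: vec_eq_iff)
qed

text \<open>Each tensor term acts on \<open>T\<close> by composition; since the Choi matrix
  determines the map, the equation can be read on maps, where the leading \<open>T\<close>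
  cancels.\<close>

lemma P_io_choi_iff:
  fixes T :: "'i::finite op \<Rightarrow> 'o::finite op"
  assumes P: "clinear_map P" "bilinear_symmetric P" and Q: "clinear_map Q" and T: "clinear_map T"
  shows "P_io P Q (choi T) = choi T \<longleftrightarrow>
    (\<forall>A. T (P A) + depol (T (P A)) = Q (T (P A)) + depol (T (depol A)))"
proof -
  let ?S = "\<lambda>A. T A - (id \<circ> T \<circ> P) A + (Q \<circ> T \<circ> P) A - (depol \<circ> T \<circ> P) A + (depol \<circ> T \<circ> depol) A"
  have S: "clinear_map ?S"
    by (intro clinear_plus clinear_minus clinear_comp clinear_id clinear_depol P Q T)
  have "P_io P Q (choi T) = choi T - choi (id \<circ> T \<circ> P) + choi (Q \<circ> T \<circ> P) - choi (depol \<circ> T \<circ> P)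
      + choi (depol \<circ> T \<circ> depol)"
    unfolding P_io_eq[OF P(1)]
    by (simp only: tensor_map_choi P Q T clinear_id clinear_depol bilinear_symmetric_depol)
  also have "\<dots> = choi ?S"
    by (simp add: vec_eq_iff choi_nth)
  finally have "P_io P Q (choi T) = choi T \<longleftrightarrow> ?S = T"
    by (simp only: choi_eq_iff[OF S T])
  also have "\<dots> \<longleftrightarrow> (\<forall>A. T (P A) + depol (T (P A)) = Q (T (P A)) + depol (T (depol A)))"
    unfolding fun_eq_iff
  proof (intro all_cong1)
    have "x - a + b - c + d = x \<longleftrightarrow> a + c = b + d" for x a b c d :: "'o op"
      by (auto simp: algebra_simps)
    then show "(?S A = T A) = (T (P A) + depol (T (P A)) = Q (T (P A)) + depol (T (depol A)))" for A
      by simp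
  qed
  finally show ?thesis .
qed

lemma maps_affine_class_iff:
  fixes T :: "'i::finite op \<Rightarrow> 'o::finite op"
  assumes P: "projector P" "self_adjoint P" "unital P"
    and Q: "projector Q" "self_adjoint Q" "unital Q"
    and T: "clinear_map T" and "\<gamma> \<noteq> 0"
  shows "(\<forall>W \<in> affine_class P \<gamma>. T W \<in> affine_class Q \<delta>) \<longleftrightarrow>
    (\<forall>A. T (P A) + depol (T (P A)) = Q (T (P A)) + depol (T (depol A))) \<and>
    trace (T (mat 1)) = \<delta> / \<gamma> * of_nat CARD('i)"
    (is "?maps \<longleftrightarrow> ?eq \<and> ?tr")
proof
  have lP: "clinear_map P" and PP: "P (P A) = P A" for A
    using P(1) by (auto simp: projector_def fun_eq_iff)
  have lQ: "clinear_map Q"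
    using Q(1) by (simp add: projector_def)
  {
    assume ?maps
    then have maps: "Q (T W) = T W \<and> trace (T W) = \<delta>" if "P W = W" "trace W = \<gamma>" for W
      using that by (auto simp: affine_class_def)
    \<comment> \<open>The multiple of the identity lying in the affine class; adding multiples of it
      adjusts the trace without leaving the range of \<open>P\<close>.\<close>
    define W0 :: "'i op" where "W0 = smat (\<gamma> / of_nat CARD('i)) (mat 1)"
    have W0: "P W0 = W0" "trace W0 = \<gamma>"
      using P(3) by (simp_all add: W0_def clinear_smat[OF lP] unital_def trace_smat trace_mat_1)
    have range: "Q (T W) = T W \<and> trace (T W) = \<delta> / \<gamma> * trace W" if W: "P W = W" for W
    proof -
      \<comment> \<open>Chosen so that \<open>W + smat c W0\<close> has trace \<gamma>: this extends
        the hypothesis from the affine class to the whole range of \<open>P\<close>.\<close>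
      define c where "c = 1 - trace W / \<gamma>"
      define V where "V = W + smat c W0"
      have "P V = V" by (simp add: V_def clinear_add[OF lP] clinear_smat[OF lP] W W0)
      moreover have "trace V = \<gamma>"
        using \<open>\<gamma> \<noteq> 0\<close> by (simp add: V_def c_def trace_add trace_smat W0 field_simps)
      ultimately have V: "Q (T V) = T V" "trace (T V) = \<delta>" using maps by auto
      have TW: "T W = T V - smat c (T W0)"
        by (simp add: V_def clinear_add[OF T] clinear_smat[OF T])
      show ?thesis
        unfolding TW using V maps[OF W0] \<open>\<gamma> \<noteq> 0\<close>
        by (simp add: clinear_diff[OF lQ] clinear_smat[OF lQ] trace_sub trace_smat c_def field_simps)
    qed
    have ?eq
    proof
      fix A
      \<comment> \<open>\<open>P A\<close> and \<open>depol A\<close> both lie in the range of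
        \<open>P\<close> and have the trace of \<open>A\<close>, so \<open>T\<close> sends them to
        operators of equal trace.\<close>
      have "depol (T (P A)) = depol (T (depol A))"
        using range[OF PP, of A] range[OF unital_depol[OF lP P(3)], of A]
        by (simp add: depol_eq_iff trace_depol trace_self_adjoint_unital[OF lP P(2,3)])
      then show "T (P A) + depol (T (P A)) = Q (T (P A)) + depol (T (depol A))"
        using range[OF PP, of A] by simp
    qed
    moreover have ?tr
      using range[of "mat 1"] P(3) by (simp add: unital_def trace_mat_1)
    ultimately show "?eq \<and> ?tr" ..
  next
    assume eqs: "?eq \<and> ?tr"
    show ?maps
    proof
      fix W assume "W \<in> affine_class P \<gamma>"
      then have W: "P W = W" "trace W = \<gamma>" by (auto simp: affine_class_def)
      have eq: "T W + depol (T W) = Q (T W) + depol (T (depol W))"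
        using eqs W(1) by metis
      \<comment> \<open>As \<open>Q\<close> preserves the trace, one copy of
        \<open>trace (T W)\<close> cancels. The \<open>depol\<close> terms of \<open>eq\<close> then
        agree, leaving the fixed-point equation for \<open>Q\<close>.\<close>
      from arg_cong[OF eq, of trace] have tr: "trace (T W) = trace (T (depol W))"
        by (simp add: trace_add trace_depol trace_self_adjoint_unital[OF lQ Q(2,3)])
      then have "depol (T W) = depol (T (depol W))" by (simp add: depol_eq_iff)
      with eq have "Q (T W) = T W" by simp
      \<comment> \<open>\<open>depol W\<close> is \<gamma>/d times the identity, with d the input
        dimension, so the condition on \<open>T (mat 1)\<close> fixes the trace.\<close>
      moreover have "trace (T (depol W)) = \<delta>"
        using eqs \<open>\<gamma> \<noteq> 0\<close> W(2) by (simp add: depol_def clinear_smat[OF T] trace_smat)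
      ultimately show "T W \<in> affine_class Q \<delta>" by (simp add: affine_class_def tr)
    qed
  }
qed

theorem theorem2:
  fixes P\<^sub>i :: "'i::finite op \<Rightarrow> 'i op"
    and P\<^sub>o :: "'o::finite op \<Rightarrow> 'o op"
    and \<gamma>\<^sub>i \<gamma>\<^sub>o :: complex
  assumes "projector P\<^sub>i" and "projector P\<^sub>o"
    and "self_adjoint P\<^sub>i" and "self_adjoint P\<^sub>o"
    and "unital P\<^sub>i" and "unital P\<^sub>o"
    and "commutes_with_transpose P\<^sub>i"
    and "\<gamma>\<^sub>i \<noteq> 0"
  shows
    "(hermiticity_preserving P\<^sub>i \<longrightarrow>
       (\<forall>T :: 'i op \<Rightarrow> 'o op. clinear_map T \<longrightarrow>
         ((\<forall>W \<in> affine_class P\<^sub>i \<gamma>\<^sub>i. T W \<in> affine_class P\<^sub>o \<gamma>\<^sub>o) \<longleftrightarrow>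
          (P_io P\<^sub>i P\<^sub>o (choi T) = choi T \<and>
           trace (choi T) = \<gamma>\<^sub>o / \<gamma>\<^sub>i * of_nat CARD('i))))) \<and>
     projector (P_io P\<^sub>i P\<^sub>o) \<and> self_adjoint (P_io P\<^sub>i P\<^sub>o) \<and> unital (P_io P\<^sub>i P\<^sub>o) \<and>
     (commutes_with_transpose P\<^sub>o \<longrightarrow> commutes_with_transpose (P_io P\<^sub>i P\<^sub>o))"
proof (intro conjI impI allI)
  have lin: "clinear_map P\<^sub>i" "clinear_map P\<^sub>o"
    using assms by (simp_all add: projector_def)
  show "(\<forall>W \<in> affine_class P\<^sub>i \<gamma>\<^sub>i. T W \<in> affine_class P\<^sub>o \<gamma>\<^sub>o) \<longleftrightarrow>
      (P_io P\<^sub>i P\<^sub>o (choi T) = choi T \<and> trace (choi T) = \<gamma>\<^sub>o / \<gamma>\<^sub>i * of_nat CARD('i))"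
    if "hermiticity_preserving P\<^sub>i" "clinear_map T" for T
    \<comment> \<open>Preservation of Hermiticity enters through \<open>bilinear_symmetricI\<close>,
      which allows \<open>P\<^sub>i\<close> to be moved from the Choi matrix to the argument of
      \<open>T\<close>.\<close>
    using that assms lin
    by (simp only: maps_affine_class_iff P_io_choi_iff bilinear_symmetricI trace_choi simp_thms)
qed (simp_all only: assms projector_P_io self_adjoint_P_io unital_P_io
    commutes_with_transpose_P_io)

end
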